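(* Let $q \geq 2$ and let $n \geq 0$, $r \geq 1$ be integers. For each $N \geq 0$ let $P_{N,q}$ be the probability measure on partitions of $N$ given by \[ P_{N,q}(\lambda) = \frac{q^N (\frac{1}{q})_N}{\prod_{j \geq 1} q^{(\lambda_j')^2} (\frac{1}{q})_{m_j(\lambda)}}, \] and let $P_{N,q}^r$ be the $P_{N,q}$-probability that $\lambda_1 < r$. Then $P_{n,q}^r \geq P_{n+1,q}^r$.
   Context: For a partition $\lambda$, $\lambda_1$ is its largest part, $m_i(\lambda)$ the number of parts equal to $i$, and $\lambda'$ the transpose partition with $\lambda_i' = m_i(\lambda)+m_{i+1}(\lambda)+\cdots$. Notation: $(x)_N = (1-x)(1-x/q)\cdots(1-x/q^{N-1})$, so $(1/q)_N = \prod_{i=1}^N(1-1/q^i)$. *)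

theory Defs
  imports "HOL-Probability.Probability"
begin

text \<open>
  A partition of \<open>N\<close> is represented by the multiset of its (positive) parts.
\<close>

definition partitions_of :: "nat \<Rightarrow> nat multiset set" where
  "partitions_of N = {l. 0 \<notin># l \<and> sum_mset l = N}"

definition largest_part :: "nat multiset \<Rightarrow> nat" where
  "largest_part l = (if l = {#} then 0 else Max (set_mset l))"

text \<open>
  The multiplicity \<open>m\<^sub>i(\<lambda>)\<close> is \<^term>\<open>count l i\<close>, which vanishes for \<open>i\<close> above the largest part.
\<close>

definition transpose_part :: "nat multiset \<Rightarrow> nat \<Rightarrow> nat" where
  "transpose_part l i = (\<Sum>k = i..largest_part l. count l k)"

definition q_poch :: "real \<Rightarrow> real \<Rightarrow> nat \<Rightarrow> real" where
  "q_poch q x N = (\<Prod>i<N. 1 - x / q ^ i)"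

text \<open>
  For \<open>j\<close> above the largest part both \<^term>\<open>transpose_part l j\<close> and \<^term>\<open>count l j\<close> are zero, so
  the factor is 1; the product over all \<open>j \<ge> 1\<close> is therefore the finite product below.
\<close>

definition partition_weight :: "real \<Rightarrow> nat \<Rightarrow> nat multiset \<Rightarrow> real" where
  "partition_weight q N l =
     q ^ N * q_poch q (1 / q) N /
     (\<Prod>j = 1..largest_part l. q ^ ((transpose_part l j)\<^sup>2) * q_poch q (1 / q) (count l j))"

text \<open>
  For \<open>q > 1\<close> all weights are positive, so the truncation in \<^const>\<open>ennreal\<close> has no effect.
\<close>

definition partition_measure :: "real \<Rightarrow> nat \<Rightarrow> nat multiset measure" where
  "partition_measure q N = point_measure (partitions_of N) (\<lambda>l. ennreal (partition_weight q N l))"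

definition prob_largest_part_less :: "real \<Rightarrow> nat \<Rightarrow> nat \<Rightarrow> real" where
  "prob_largest_part_less q r N = \<P>(l in partition_measure q N. largest_part l < r)"

lemma finite_partitions_of: "finite (partitions_of N)"
proof (rule finite_subset)
  show "partitions_of N \<subseteq> mset ` {xs. set xs \<subseteq> {..N} \<and> length xs \<le> N}"
  proof
    fix l assume l: "l \<in> partitions_of N"
    obtain xs where xs: "l = mset xs" by (metis ex_mset)
    have "0 \<notin> set xs" and s: "sum_list xs = N"
      using l by (auto simp: partitions_of_def xs sum_mset_sum_list)
    have "set xs \<subseteq> {..N}" using s member_le_sum_list by auto
    moreover have "length xs \<le> sum_list xs" using \<open>0 \<notin> set xs\<close>
      by (induction xs) (auto simp: Suc_le_eq)
    ultimately show "l \<in> mset ` {xs. set xs \<subseteq> {..N} \<and> length xs \<le> N}"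
      using xs s by auto
  qed
qed (simp add: finite_lists_length_le)

lemma q_poch_pos:
  assumes "q > 1" shows "q_poch q (1 / q) N > 0"
  unfolding q_poch_def
proof (rule prod_pos, clarify)
  fix i
  have "1 < q ^ Suc i" using assms by (rule one_less_power) simp
  then show "0 < 1 - 1 / q / q ^ i" using assms by (simp add: field_simps)
qed

lemma partition_weight_pos:
  assumes "q > 1" shows "partition_weight q N l > 0"
  unfolding partition_weight_def using assms
  by (intro divide_pos_pos mult_pos_pos prod_pos zero_less_power q_poch_pos ballI) auto

lemma prob_largest_part_less_eq_sum:
  assumes "q > 1"
  shows "prob_largest_part_less q r N =
    (\<Sum>l \<in> {l \<in> partitions_of N. largest_part l < r}. partition_weight q N l)"
proof -
  let ?A = "{l \<in> partitions_of N. largest_part l < r}"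
  have nn: "0 \<le> partition_weight q N l" for l
    using partition_weight_pos[OF assms] by (rule less_imp_le)
  have "emeasure (partition_measure q N) ?A = (\<Sum>l\<in>?A. ennreal (partition_weight q N l))"
    unfolding partition_measure_def
    by (rule emeasure_point_measure_finite) (auto simp: finite_partitions_of)
  also have "\<dots> = ennreal (\<Sum>l\<in>?A. partition_weight q N l)"
    by (rule sum_ennreal) (rule nn)
  finally have "emeasure (partition_measure q N) ?A =
    ennreal (\<Sum>l\<in>?A. partition_weight q N l)" .
  then show ?thesis
    by (simp add: prob_largest_part_less_def measure_def partition_measure_def space_point_measure
        sum_nonneg nn)
qed

end

theory Submission
  imports Defs
begin

text \<open>
  For prime powers \<open>q\<close>, \<open>P\<^sub>N\<close> is the law of the Jordan type of a uniform nilpotent matrix of size \<open>N\<close>,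
  with \<open>\<lambda>'\<^sub>1\<close> the dimension of its kernel. Quotienting a nilpotent matrix by a line in its kernel
  cannot increase \<open>\<lambda>\<^sub>1\<close>, and a uniform pair of a nilpotent matrix of size \<open>n + 1\<close> and such a line has a
  uniform nilpotent quotient. So \<open>P\<^sub>n(\<lambda>\<^sub>1 < r)\<close> is at least the probability of \<open>\<lambda>\<^sub>1 < r\<close> under \<open>P\<^sub>n\<^sub>+\<^sub>1\<close>
  reweighted by \<open>q^\<lambda>'\<^sub>1 - 1\<close>. By Chebyshev's inequality this reweighting does not decrease the
  probability, provided that \<open>P\<^sub>N(\<lambda>\<^sub>1 < r | \<lambda>'\<^sub>1 = a)\<close> is nondecreasing in \<open>a\<close>. The latter follows by
  induction on \<open>r\<close>: removing the first column leaves a partition of \<open>N - a\<close> with weight multiplied by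
  \<open>1 / (1/q)\<^bsub>a - \<lambda>'\<^sub>1\<^esub>\<close>, and the same argument applies to these weights, because the line-quotient
  relation maps them to constant multiples of themselves. In terms of partition sums every step is an
  identity or inequality that makes sense for real \<open>q > 1\<close>.
\<close>

section \<open>Cross-multiplied inequalities\<close>

text \<open>Chebyshev's sum inequality for ratios \<open>f / g\<close> and \<open>u / w\<close> that
  vary in the same direction, cleared of denominators. Twice the difference of the two sides is the
  double sum of the products in the hypothesis.\<close>

lemma sum_Binet_Cauchy_le:
  fixes f g u w :: "'i \<Rightarrow> real"
  assumes "\<And>i j. i \<in> A \<Longrightarrow> j \<in> A \<Longrightarrow> 0 \<le> (f i * g j - f j * g i) * (u i * w j - u j * w i)"
  shows "(\<Sum>i\<in>A. f i * w i) * (\<Sum>i\<in>A. g i * u i) \<le> (\<Sum>i\<in>A. f i * u i) * (\<Sum>i\<in>A. g i * w i)"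
proof -
  let ?P = "\<lambda>p s. (\<Sum>i\<in>A. p i) * (\<Sum>i\<in>A. s i) :: real"
  have swap: "(\<Sum>i\<in>A. \<Sum>j\<in>A. p i * s j) = ?P p s" for p s :: "'i \<Rightarrow> real"
    by (simp add: sum_product)
  have "0 \<le> (\<Sum>i\<in>A. \<Sum>j\<in>A. (f i * g j - f j * g i) * (u i * w j - u j * w i))"
    by (intro sum_nonneg assms)
  also have "\<dots> = (\<Sum>i\<in>A. \<Sum>j\<in>A. (f i * u i) * (g j * w j) + (g i * w i) * (f j * u j)
      - (g i * u i) * (f j * w j) - (f i * w i) * (g j * u j))"
    by (intro sum.cong refl) (simp add: algebra_simps)
  also have "\<dots> = 2 * (?P (\<lambda>i. f i * u i) (\<lambda>i. g i * w i) - ?P (\<lambda>i. f i * w i) (\<lambda>i. g i * u i))"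
    unfolding sum.distrib sum_subtractf swap by (simp add: mult_ac)
  finally show ?thesis by simp
qed

lemma cross_mult_le_trans:
  fixes a b c d e f :: real
  assumes "a * d \<le> c * b" "c * f \<le> e * d" "0 \<le> b" "0 < d" "0 \<le> f"
  shows "a * f \<le> e * b"
proof -
  have "a * d * f \<le> c * b * f"
    using assms by (intro mult_right_mono)
  also have "\<dots> = c * f * b" by simp
  also have "\<dots> \<le> e * d * b"
    using assms by (intro mult_right_mono)
  finally have "d * (a * f) \<le> d * (e * b)" by (simp add: mult_ac)
  then show ?thesis using \<open>0 < d\<close> by simp
qed

section \<open>Partitions and their first columns\<close>

lemma size_le_sum_mset: "0 \<notin># l \<Longrightarrow> size l \<le> sum_mset (l :: nat multiset)"
  by (induction l) auto

lemma le_largest_part: "p \<in># l \<Longrightarrow> p \<le> largest_part l"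
  by (auto simp: largest_part_def)

lemma transpose_part_eq: "transpose_part l i = size (filter_mset ((\<le>) i) l)"
proof -
  have "size (filter_mset ((\<le>) i) l) = (\<Sum>k\<in>{k \<in> set_mset l. i \<le> k}. count l k)"
    unfolding size_multiset_overloaded_eq by (rule sum.cong) auto
  also have "\<dots> = (\<Sum>k = i..largest_part l. count l k)"
    by (rule sum.mono_neutral_left) (auto simp: le_largest_part count_eq_zero_iff)
  finally show ?thesis by (simp add: transpose_part_def)
qed

definition bounded_partitions :: "nat \<Rightarrow> nat \<Rightarrow> nat multiset set" where
  "bounded_partitions r N = {l. 0 \<notin># l \<and> sum_mset l = N \<and> (\<forall>p\<in>#l. p \<le> r)}"

lemma bounded_partitions_alt:
  "bounded_partitions r N = {l \<in> partitions_of N. largest_part l \<le> r}"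
  by (auto simp: bounded_partitions_def partitions_of_def largest_part_def)

lemma finite_bounded_partitions: "finite (bounded_partitions r N)"
  unfolding bounded_partitions_alt by (simp add: finite_partitions_of)

lemma size_bounded_partitions: "l \<in> bounded_partitions r N \<Longrightarrow> size l \<le> N"
  using size_le_sum_mset by (auto simp: bounded_partitions_def)

lemma bounded_partitions_0: "bounded_partitions 0 N = (if N = 0 then {{#}} else {})"
proof (rule set_eqI)
  fix l show "l \<in> bounded_partitions 0 N \<longleftrightarrow> l \<in> (if N = 0 then {{#}} else {})"
    by (cases l) (auto simp: bounded_partitions_def)
qed

text \<open>In the Young diagram this puts a new first column of length \<open>a\<close> before
  \<open>m\<close>, which makes sense for \<open>size m \<le> a\<close>.\<close>

definition add_column :: "nat \<Rightarrow> nat multiset \<Rightarrow> nat multiset" where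
  "add_column a m = image_mset Suc m + replicate_mset (a - size m) 1"

definition remove_column :: "nat multiset \<Rightarrow> nat multiset" where
  "remove_column l = filter_mset ((<) 0) (image_mset (\<lambda>p. p - 1) l)"

lemma size_add_column: "size m \<le> a \<Longrightarrow> size (add_column a m) = a"
  by (simp add: add_column_def)

lemma sum_add_column: "size m \<le> a \<Longrightarrow> sum_mset (add_column a m) = sum_mset m + a"
proof -
  have "sum_mset (image_mset Suc m) = sum_mset m + size m"
    by (induction m) auto
  then show "size m \<le> a \<Longrightarrow> ?thesis" by (simp add: add_column_def)
qed

lemma count_add_column_1: "0 \<notin># m \<Longrightarrow> count (add_column a m) (Suc 0) = a - size m"
  by (simp add: add_column_def count_eq_zero_iff image_iff)

lemma count_add_column: "count (add_column a m) (Suc (Suc j)) = count m (Suc j)"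
  by (simp add: add_column_def) (induction m; simp)

lemma filter_add_column_1: "filter_mset ((\<le>) (Suc 0)) (add_column a m) = add_column a m"
  unfolding add_column_def filter_mset_eq_conv by auto

lemma size_filter_add_column:
  "size (filter_mset ((\<le>) (Suc (Suc j))) (add_column a m)) = size (filter_mset ((\<le>) (Suc j)) m)"
proof -
  have "filter_mset ((\<le>) (Suc (Suc j))) (replicate_mset n 1) = {#}" for n
    by (induction n) auto
  then show ?thesis by (simp add: add_column_def filter_mset_image_mset)
qed

lemma remove_add_column:
  assumes "0 \<notin># m"
  shows "remove_column (add_column a m) = m"
proof -
  have "image_mset (\<lambda>p. p - 1) (image_mset Suc m) = m"
    by (induction m) auto
  then have image: "image_mset (\<lambda>p. p - 1) (add_column a m) = m + replicate_mset (a - size m) 0"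
    by (simp add: add_column_def)
  have zeros: "filter_mset ((<) 0) (replicate_mset n (0 :: nat)) = {#}" for n
    by (simp add: filter_mset_eq_conv)
  have "0 < p" if "p \<in># m" for p
    using that assms by (cases "p = 0") simp_all
  then have "filter_mset ((<) 0) m = m"
    by (simp only: filter_mset_eq_conv) simp
  then show ?thesis
    unfolding remove_column_def image filter_union_mset zeros by (simp only: add_0_right)
qed

lemma size_remove_column: "size (remove_column l) \<le> size l"
  unfolding remove_column_def by (metis size_filter_mset_lesseq size_image_mset)

lemma add_remove_column: "0 \<notin># l \<Longrightarrow> add_column (size l) (remove_column l) = l"
proof (induction l)
  case (add p l)
  then have "Suc (size l) - size (remove_column l) = Suc (size l - size (remove_column l))"
    using size_remove_column[of l] by simp
  with add show ?case
    by (cases p; cases "p = 1") (auto simp: add_column_def remove_column_def)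
qed (simp add: add_column_def remove_column_def)

lemma bij_betw_add_column:
  assumes "a \<le> N"
  shows "bij_betw (add_column a) {m. m \<in> bounded_partitions r (N - a) \<and> size m \<le> a}
           {l. l \<in> bounded_partitions (Suc r) N \<and> size l = a}"
proof (rule bij_betw_byWitness[where f' = remove_column])
  show "remove_column ` {l. l \<in> bounded_partitions (Suc r) N \<and> size l = a}
      \<subseteq> {m. m \<in> bounded_partitions r (N - a) \<and> size m \<le> a}"
  proof clarify
    fix l assume l: "l \<in> bounded_partitions (Suc r) N"
    have "sum_mset (remove_column l) + size l = N"
      using l sum_add_column[OF size_remove_column[of l]]
      by (simp add: add_remove_column bounded_partitions_def)
    then show "remove_column l \<in> bounded_partitions r (N - size l) \<and> size (remove_column l) \<le> size l"
      using l size_remove_column[of l] by (auto simp: bounded_partitions_def remove_column_def)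
  qed
qed (use assms in \<open>auto simp: bounded_partitions_def remove_add_column add_remove_column
      size_add_column sum_add_column, auto simp: add_column_def split: if_splits\<close>)

section \<open>Weighted partition sums, column by column, with \<open>x = 1/q\<close>\<close>

locale base_inverse =
  fixes x :: real
  assumes x_pos: "0 < x" and x_less_1: "x < 1"
begin

definition qfact :: "nat \<Rightarrow> real" where
  "qfact n = (\<Prod>i<n. 1 - x ^ Suc i)"

lemma power_less_1: "x ^ Suc i < 1"
  using x_pos x_less_1 power_Suc_less_one by blast

lemma qfact_0 [simp]: "qfact 0 = 1"
  by (simp add: qfact_def)

lemma qfact_Suc: "qfact (Suc n) = (1 - x ^ Suc n) * qfact n"
  by (simp add: qfact_def)

lemma qfact_pos: "0 < qfact n"
  unfolding qfact_def using power_less_1 by (intro prod_pos) (simp del: power_Suc)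

text \<open>The factor for the parts equal to 1 when a column of length \<open>k\<close> is put
  before a partition with \<open>b\<close> parts; there are \<open>k - b\<close> of them. The value
  0 for \<open>b > k\<close> discards impossible columns.\<close>

definition col_weight :: "nat \<Rightarrow> nat \<Rightarrow> real" where
  "col_weight k b = (if b \<le> k then 1 / qfact (k - b) else 0)"

lemma col_weight_nonneg: "0 \<le> col_weight k b"
  by (simp add: col_weight_def qfact_pos less_imp_le)

lemma col_weight_pos: "b \<le> k \<Longrightarrow> 0 < col_weight k b"
  by (simp add: col_weight_def qfact_pos)

lemma col_weight_Suc:
  "col_weight k b = (1 - x ^ Suc k / x ^ b) * col_weight (Suc k) b"
proof -
  consider "b \<le> k" | "b = Suc k" | "b > Suc k" by linarith
  then show ?thesis
  proof cases
    case 1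
    then have "x ^ Suc k / x ^ b = x ^ Suc (k - b)"
      using x_pos by (simp add: power_diff)
    with 1 show ?thesis
      using power_less_1[of "k - b"] qfact_pos[of "k - b"]
      by (simp add: col_weight_def Suc_diff_le qfact_Suc del: power_Suc)
  qed (use x_pos in \<open>auto simp: col_weight_def\<close>)
qed

text \<open>A random lift of a nilpotent matrix with kernel dimension \<open>b\<close> has kernel
  dimension \<open>b + 1\<close> with probability \<open>x ^ b\<close>, and \<open>b\<close>
  otherwise. The column weights are eigenvectors of this averaging.\<close>

lemma col_weight_shift:
  "x ^ b * col_weight k (Suc b) + (1 - x ^ b) * col_weight k b = (1 - x ^ k) * col_weight k b"
proof -
  consider "b < k" | "b = k" | "b > k" by linarith
  then show ?thesis
  proof cases
    case 1
    then obtain d where k: "k = Suc (b + d)" using less_imp_Suc_add by blast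
    have Suc: "col_weight k (Suc b) = (1 - x ^ Suc d) * col_weight k b"
      using power_less_1[of d] by (simp add: col_weight_def k Suc_diff_le qfact_Suc del: power_Suc)
    show ?thesis unfolding Suc by (simp add: k algebra_simps power_add)
  qed (auto simp: col_weight_def)
qed

text \<open>
  \<open>colsum r N a\<close> is the sum of \<open>1 / (\<Prod>j. q^(\<lambda>'\<^sub>j\<^sup>2) (1/q)\<^bsub>m\<^sub>j\<^esub>)\<close>, where \<open>x = 1/q\<close>, over the partitions of \<open>N\<close>
  with \<open>a\<close> parts, all at most \<open>r\<close>; the recursion removes the first column.
\<close>
primrec colsum :: "nat \<Rightarrow> nat \<Rightarrow> nat \<Rightarrow> real" where
  "colsum 0 N a = (if N = 0 \<and> a = 0 then 1 else 0)"
| "colsum (Suc r) N a =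
    (if a \<le> N then x ^ a\<^sup>2 * (\<Sum>b\<le>N - a. colsum r (N - a) b * col_weight a b) else 0)"

definition wsum :: "(nat \<Rightarrow> real) \<Rightarrow> nat \<Rightarrow> nat \<Rightarrow> real" where
  "wsum v r N = (\<Sum>b\<le>N. colsum r N b * v b)"

lemma colsum_Suc:
  "colsum (Suc r) N a = (if a \<le> N then x ^ a\<^sup>2 * wsum (col_weight a) r (N - a) else 0)"
  by (simp add: wsum_def)

declare colsum.simps(2) [simp del]

lemma colsum_nonneg: "0 \<le> colsum r N a"
  by (induction r arbitrary: N a)
    (auto simp: colsum.simps intro!: mult_nonneg_nonneg sum_nonneg col_weight_nonneg
      zero_le_power less_imp_le[OF x_pos])

lemma colsum_eq_0: "N < a \<Longrightarrow> colsum r N a = 0"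
  by (cases r) (auto simp: colsum_Suc)

lemma colsum_no_parts: "colsum r N 0 = (if N = 0 then 1 else 0)"
proof (induction r arbitrary: N)
  case (Suc r)
  have "(\<Sum>b\<le>N. colsum r N b * col_weight 0 b) = (\<Sum>b\<in>{0}. colsum r N b * col_weight 0 b)"
    by (rule sum.mono_neutral_right) (auto simp: col_weight_def)
  then show ?case by (simp add: colsum_Suc wsum_def Suc col_weight_def)
qed simp

lemma wsum_0: "wsum v r 0 = v 0"
  by (simp add: wsum_def colsum_no_parts)

lemma wsum_col_weight_pos_aux:
  assumes "1 \<le> k" "0 < colsum R M (min 1 M)"
  shows "0 < wsum (col_weight k) R M"
proof -
  \<comment> \<open>One positive term suffices: \<open>b = 1\<close>, or \<open>b = 0\<close> if
    \<open>M = 0\<close>.\<close>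
  have "0 < colsum R M (min 1 M) * col_weight k (min 1 M)"
    using assms by (intro mult_pos_pos col_weight_pos) auto
  also have "\<dots> \<le> wsum (col_weight k) R M"
    unfolding wsum_def
    by (rule member_le_sum) (auto intro!: mult_nonneg_nonneg colsum_nonneg col_weight_nonneg)
  finally show ?thesis .
qed

lemma colsum_pos: "1 \<le> a \<Longrightarrow> a \<le> N \<Longrightarrow> N \<le> R \<Longrightarrow> 0 < colsum R N a"
proof (induction R arbitrary: N a)
  case (Suc R)
  have "0 < colsum R (N - a) (min 1 (N - a))"
    using Suc by (cases "N = a") (auto simp: colsum_no_parts min_def)
  with Suc.prems x_pos show ?case
    by (simp add: colsum_Suc wsum_col_weight_pos_aux)
qed simp

lemma wsum_col_weight_pos:
  assumes "1 \<le> k" "M \<le> R"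
  shows "0 < wsum (col_weight k) R M"
proof -
  have "0 < colsum R M (min 1 M)"
    using assms colsum_pos[of 1 M R] by (cases "M = 0") (auto simp: colsum_no_parts min_def)
  with assms show ?thesis by (intro wsum_col_weight_pos_aux)
qed

section \<open>Quotients by a line in the kernel\<close>

text \<open>
  For prime powers \<open>q\<close> this is, up to normalisation, the number of pairs of a nilpotent matrix \<open>A\<close> of
  size \<open>M + 1\<close> with kernel of dimension \<open>a + 1\<close> and a line in that kernel such that the quotient
  matrix \<open>B\<close> satisfies \<open>B^r = 0\<close> but \<open>A^r \<noteq> 0\<close>; the kernel of \<open>B\<close> has dimension \<open>a\<close> or \<open>a + 1\<close>.
\<close>
definition deficit :: "nat \<Rightarrow> nat \<Rightarrow> nat \<Rightarrow> real" where
  "deficit r M a = x ^ Suc a * (x ^ a * colsum r M a + (1 - x ^ Suc a) * colsum r M (Suc a))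
     - (1 - x ^ Suc a) * colsum r (Suc M) (Suc a)"

text \<open>Pairs of a matrix and a line, counted from the quotient and from the matrix, where the
  number of lines is proportional to \<open>1 / x ^ a - 1\<close>. The boundary terms vanish: both
  factors are 0 at kernel dimension 0, and \<open>colsum r M (Suc M) = 0\<close>.\<close>

lemma wsum_deficit:
  "wsum (\<lambda>b. x ^ b * v (Suc b) + (1 - x ^ b) * v b) r M - wsum (\<lambda>a. (1 / x ^ a - 1) * v a) r (Suc M)
    = (\<Sum>b\<le>M. deficit r M b * v (Suc b) / x ^ Suc b)"
proof -
  have lower: "(\<Sum>b\<le>M. colsum r M b * ((1 - x ^ b) * v b))
      = (\<Sum>b\<le>M. colsum r M (Suc b) * ((1 - x ^ Suc b) * v (Suc b)))"
    using sum.atMost_Suc_shift[of "\<lambda>b. colsum r M b * ((1 - x ^ b) * v b)" M]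
    by (simp add: colsum_eq_0)
  have upper: "wsum (\<lambda>a. (1 / x ^ a - 1) * v a) r (Suc M)
      = (\<Sum>b\<le>M. colsum r (Suc M) (Suc b) * ((1 / x ^ Suc b - 1) * v (Suc b)))"
    unfolding wsum_def by (subst sum.atMost_Suc_shift) simp
  have summand: "deficit r M b * v (Suc b) / x ^ Suc b =
      colsum r M b * (x ^ b * v (Suc b)) + colsum r M (Suc b) * ((1 - x ^ Suc b) * v (Suc b))
      - colsum r (Suc M) (Suc b) * ((1 / x ^ Suc b - 1) * v (Suc b))" for b
    using x_pos unfolding deficit_def by (simp add: field_simps)
  show ?thesis
    unfolding summand upper sum.distrib sum_subtractf lower[symmetric]
    by (simp add: wsum_def sum.distrib distrib_left)
qed

lemma wsum_cmult: "wsum (\<lambda>b. c * v b) r M = c * wsum v r M"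
  by (simp add: wsum_def sum_distrib_left mult.left_commute)

lemma wsum_col_weight_Suc:
  "wsum (col_weight k) r M = (1 - x ^ Suc k) * wsum (col_weight (Suc k)) r M
     - x ^ Suc k * wsum (\<lambda>b. (1 / x ^ b - 1) * col_weight (Suc k) b) r M"
  unfolding wsum_def sum_distrib_left sum_subtractf[symmetric]
  by (intro sum.cong refl, subst col_weight_Suc) (simp add: algebra_simps)

lemma wsum_col_weight_deficit:
  "(1 - x ^ k) * wsum (col_weight k) r M - wsum (\<lambda>b. (1 / x ^ b - 1) * col_weight k b) r (Suc M)
     = (\<Sum>b\<le>M. deficit r M b * col_weight k (Suc b) / x ^ Suc b)"
  using wsum_deficit[of "col_weight k" r M] unfolding col_weight_shift wsum_cmult .

text \<open>Removing the first columns and rewriting weight \<open>a\<close> by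
  \<open>wsum_col_weight_Suc\<close> leaves the left side of \<open>wsum_col_weight_deficit\<close>.
  So deficits for \<open>Suc r\<close> are nonnegative combinations of those for
  \<open>r\<close>.\<close>

lemma deficit_Suc:
  "deficit (Suc r) M a = (if a < M then x ^ ((Suc a)\<^sup>2 + Suc a) *
     (\<Sum>b\<le>M - Suc a. deficit r (M - Suc a) b * col_weight (Suc a) (Suc b) / x ^ Suc b) else 0)"
proof -
  have pow: "x ^ Suc a * (x ^ a * x ^ a\<^sup>2) = x ^ (Suc a)\<^sup>2"
    by (simp add: power2_eq_square flip: power_add)
  consider "M < a" | "M = a" | "a < M" by linarith
  then show ?thesis
  proof cases
    case 2
    \<comment> \<open>Only single columns remain, and they cancel.\<close>
    have "deficit (Suc r) M a = x ^ Suc a * (x ^ a * x ^ a\<^sup>2) * col_weight a 0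
        - x ^ (Suc a)\<^sup>2 * ((1 - x ^ Suc a) * col_weight (Suc a) 0)"
      using 2 unfolding deficit_def colsum_Suc by (simp add: wsum_0 mult_ac)
    also have "\<dots> = 0"
      unfolding pow using col_weight_Suc[of a 0] by simp
    finally show ?thesis using 2 by simp
  next
    case 3
    then obtain m where M: "M = Suc a + m" using less_imp_Suc_add by force
    let ?h = "\<lambda>b. (1 / x ^ b - 1) * col_weight (Suc a) b"
    have d: "M - a = Suc m" "Suc M - Suc a = Suc m" "M - Suc a = m" by (auto simp: M)
    have "deficit (Suc r) M a = x ^ Suc a * (x ^ a * x ^ a\<^sup>2) * wsum (col_weight a) r (Suc m)
        + (1 - x ^ Suc a) * x ^ (Suc a)\<^sup>2 *
          (x ^ Suc a * wsum (col_weight (Suc a)) r m - wsum (col_weight (Suc a)) r (Suc m))"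
      using 3 unfolding deficit_def colsum_Suc d by (simp add: algebra_simps)
    also have "\<dots> = x ^ ((Suc a)\<^sup>2 + Suc a) *
        ((1 - x ^ Suc a) * wsum (col_weight (Suc a)) r m - wsum ?h r (Suc m))"
      unfolding pow wsum_col_weight_Suc[of a] power_add by (simp add: algebra_simps)
    finally show ?thesis
      using 3 unfolding wsum_col_weight_deficit d by simp
  qed (simp add: deficit_def colsum_eq_0)
qed

lemma deficit_nonneg: "0 \<le> deficit r M a"
proof (induction r arbitrary: M a)
  case 0
  then show ?case using x_pos by (simp add: deficit_def)
next
  case (Suc r)
  then show ?case unfolding deficit_Suc
    using x_pos by (auto intro!: mult_nonneg_nonneg sum_nonneg col_weight_nonneg divide_nonneg_nonneg)
qed

text \<open>A nilpotent matrix \<open>A\<close> of size \<open>M + 1 \<le> R\<close> always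
  satisfies \<open>A^R = 0\<close>.\<close>

lemma deficit_eq_0: "M < R \<Longrightarrow> deficit R M a = 0"
proof (induction R arbitrary: M a)
  case (Suc R)
  then show ?case unfolding deficit_Suc by simp
qed simp

section \<open>Monotonicity in the number of parts\<close>

text \<open>For \<open>N \<le> R\<close> the bound \<open>R\<close> excludes no partition, so this
  says that the conditional probability of having all parts at most \<open>r\<close>, given
  \<open>a\<close> parts, is nondecreasing in \<open>a\<close>.\<close>

definition ratio_mono :: "nat \<Rightarrow> nat \<Rightarrow> nat \<Rightarrow> bool" where
  "ratio_mono r R N \<longleftrightarrow>
     (\<forall>a b. a \<le> b \<longrightarrow> b \<le> N \<longrightarrow> colsum r N a * colsum R N b \<le> colsum r N b * colsum R N a)"

lemma wsum_ratio_mono: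
  assumes "ratio_mono r R N"
    and "\<And>a b. a \<le> b \<Longrightarrow> b \<le> N \<Longrightarrow> u a * w b \<le> u b * w a"
  shows "wsum w r N * wsum u R N \<le> wsum u r N * wsum w R N"
  unfolding wsum_def
proof (rule sum_Binet_Cauchy_le)
  fix i j assume ij: "i \<in> {..N}" "j \<in> {..N}"
  have le: "colsum r N a * colsum R N b \<le> colsum r N b * colsum R N a" "u a * w b \<le> u b * w a"
    if "a \<le> b" "b \<le> N" for a b
    using assms that by (simp_all add: ratio_mono_def)
  show "0 \<le> (colsum r N i * colsum R N j - colsum r N j * colsum R N i) * (u i * w j - u j * w i)"
  proof (cases "i \<le> j")
    case True
    then show ?thesis using ij by (intro mult_nonpos_nonpos) (simp_all add: le)
  next
    case False
    then show ?thesis using ij by (intro mult_nonneg_nonneg) (simp_all add: le)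
  qed
qed

text \<open>For \<open>R > M\<close> the identity \<open>wsum_deficit\<close> has no deficit; for
  \<open>r\<close> it has a nonnegative one. The reweighting by \<open>1 / x ^ a - 1\<close>
  increases with \<open>a\<close>, so Chebyshev's inequality applies.\<close>

lemma wsum_ratio_antimono:
  assumes "ratio_mono r R (Suc M)" and "M < R" and "0 < c"
    and nonneg: "\<And>b. 0 \<le> v b"
    and shift: "\<And>b. x ^ b * v (Suc b) + (1 - x ^ b) * v b = c * v b"
  shows "wsum v r (Suc M) * wsum v R M \<le> wsum v r M * wsum v R (Suc M)"
proof -
  let ?u = "\<lambda>a. (1 / x ^ a - 1) * v a"
  have id: "c * wsum v s M - wsum ?u s (Suc M) = (\<Sum>b\<le>M. deficit s M b * v (Suc b) / x ^ Suc b)" for s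
    using wsum_deficit[of v s M] unfolding shift wsum_cmult .
  have R: "wsum ?u R (Suc M) = c * wsum v R M"
    using id[of R] \<open>M < R\<close> by (simp add: deficit_eq_0)
  have r: "wsum ?u r (Suc M) \<le> c * wsum v r M"
  proof -
    have "0 \<le> (\<Sum>b\<le>M. deficit r M b * v (Suc b) / x ^ Suc b)"
      using x_pos by (intro sum_nonneg divide_nonneg_nonneg mult_nonneg_nonneg deficit_nonneg nonneg) auto
    then show ?thesis using id[of r] by simp
  qed
  have "wsum v r (Suc M) * wsum ?u R (Suc M) \<le> wsum ?u r (Suc M) * wsum v R (Suc M)"
  proof (rule wsum_ratio_mono[OF assms(1)])
    fix a b :: nat assume "a \<le> b"
    then have "1 / x ^ a - 1 \<le> 1 / x ^ b - 1"
      using x_pos x_less_1 by (simp add: frac_le power_decreasing)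
    from mult_right_mono[OF this mult_nonneg_nonneg[OF nonneg[of a] nonneg[of b]]]
    show "?u a * v b \<le> ?u b * v a" by (simp add: mult_ac)
  qed
  also have "\<dots> \<le> c * wsum v r M * wsum v R (Suc M)"
    by (intro mult_right_mono r) (simp add: wsum_def sum_nonneg colsum_nonneg nonneg)
  finally show ?thesis
    using \<open>0 < c\<close> unfolding R by (simp add: mult.assoc mult.left_commute)
qed

lemma col_weight_ratio_mono:
  assumes "a \<le> b"
  shows "col_weight (Suc k) a * col_weight k b \<le> col_weight (Suc k) b * col_weight k a"
proof -
  have "x ^ Suc k / x ^ a \<le> x ^ Suc k / x ^ b"
    using assms x_pos x_less_1 by (intro divide_left_mono power_decreasing) auto
  then have "(1 - x ^ Suc k / x ^ b) * (col_weight (Suc k) a * col_weight (Suc k) b) \<le>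
      (1 - x ^ Suc k / x ^ a) * (col_weight (Suc k) a * col_weight (Suc k) b)"
    by (intro mult_right_mono mult_nonneg_nonneg col_weight_nonneg) auto
  then show ?thesis
    unfolding col_weight_Suc[of k] by (simp add: mult_ac)
qed

lemma ratio_mono: "N \<le> R \<Longrightarrow> ratio_mono r R N"
proof (induction r arbitrary: N R)
  case 0
  then show ?case
    by (auto simp: ratio_mono_def colsum_nonneg)
next
  case (Suc r)
  show ?case
    unfolding ratio_mono_def
  proof (intro allI impI)
    fix a b assume ab: "a \<le> b" "b \<le> N"
    show "colsum (Suc r) N a * colsum R N b \<le> colsum (Suc r) N b * colsum R N a"
    proof (cases "a = 0")
      case True
      with ab show ?thesis by (cases "N = 0") (auto simp: colsum_no_parts colsum_nonneg)
    next
      case False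
      with ab Suc.prems obtain R' where R: "R = Suc R'" by (cases R) auto
      let ?U = "\<lambda>s c. wsum (col_weight c) s (N - c)"
      have step: "?U r a * ?U R' b \<le> ?U r b * ?U R' a"
        using ab
      proof (induction b rule: dec_induct)
        case (step c)
        define M where "M = N - Suc c"
        have M: "N - c = Suc M" using step by (simp add: M_def)
        have c: "1 \<le> c" using False step by simp
        \<comment> \<open>As \<open>c \<ge> 1\<close>, the bound \<open>R'\<close> still excludes no
          partition of the remaining size.\<close>
        have MR: "Suc M \<le> R'" using Suc.prems c M by (simp add: R)
        have IH: "ratio_mono r R' M" "ratio_mono r R' (Suc M)"
          using MR by (auto intro: Suc.IH)
        \<comment> \<open>From \<open>c\<close> to \<open>Suc c\<close> the ratio of
          \<open>?U r\<close> to \<open>?U R'\<close> does not fall: first the remaining size drops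
          by one, then the column weight changes.\<close>
        have 1: "wsum (col_weight c) r (Suc M) * wsum (col_weight c) R' M
            \<le> wsum (col_weight c) r M * wsum (col_weight c) R' (Suc M)"
        proof (rule wsum_ratio_antimono[OF IH(2) _ _ col_weight_nonneg col_weight_shift])
          show "0 < 1 - x ^ c" using power_less_1[of "c - 1"] c by simp
        qed (use MR in simp)
        have 2: "wsum (col_weight c) r M * wsum (col_weight (Suc c)) R' M
            \<le> wsum (col_weight (Suc c)) r M * wsum (col_weight c) R' M"
          by (rule wsum_ratio_mono[OF IH(1) col_weight_ratio_mono])
        have 3: "?U r a * wsum (col_weight c) R' (Suc M)
            \<le> wsum (col_weight c) r (Suc M) * ?U R' a"
          using step.IH step.hyps step.prems unfolding M[symmetric] by simp
        have pos: "0 < wsum (col_weight c) R' M" "0 < wsum (col_weight c) R' (Suc M)"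
          "0 < wsum (col_weight (Suc c)) R' M"
          using c MR by (simp_all add: wsum_col_weight_pos)
        have "0 < ?U R' a"
          using False Suc.prems R by (intro wsum_col_weight_pos) auto
        with 3 1 have "?U r a * wsum (col_weight c) R' M \<le> wsum (col_weight c) r M * ?U R' a"
          using pos by (intro cross_mult_le_trans[OF 3 1]) simp_all
        from this 2 show ?case
          unfolding M_def[symmetric]
          by (rule cross_mult_le_trans) (use pos \<open>0 < ?U R' a\<close> in simp_all)
      qed simp
      then have "(x ^ a\<^sup>2 * x ^ b\<^sup>2) * (?U r a * ?U R' b) \<le> (x ^ a\<^sup>2 * x ^ b\<^sup>2) * (?U r b * ?U R' a)"
        by (rule mult_left_mono) (use x_pos in simp)
      moreover have "colsum (Suc s) N c = x ^ c\<^sup>2 * ?U s c" if "c \<in> {a, b}" for s c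
        using that ab by (auto simp: colsum_Suc)
      ultimately show ?thesis
        unfolding R by (simp only: mult_ac insert_iff simp_thms)
    qed
  qed
qed

section \<open>Normalisation\<close>

lemma wsum_col_weight_0: "wsum (col_weight 0) r M = (if M = 0 then 1 else 0)"
proof -
  have "wsum (col_weight 0) r M = (\<Sum>b\<in>{0}. colsum r M b * col_weight 0 b)"
    unfolding wsum_def by (rule sum.mono_neutral_right) (auto simp: col_weight_def)
  then show ?thesis by (simp add: colsum_no_parts col_weight_def)
qed

text \<open>Without deficits the line-quotient identity becomes a recursion of q-Pascal type in
  \<open>k\<close> and \<open>M\<close>. The closed form serves to find the total mass by letting
  \<open>k\<close> tend to infinity.\<close>

lemma wsum_col_weight_closed:
  "M \<le> R \<Longrightarrow> qfact k * wsum (col_weight k) R M * qfact M = x ^ M * (\<Prod>i<M. 1 - x ^ (k + i))"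
proof (induction M arbitrary: k)
  case 0
  then show ?case using qfact_pos[of k] by (simp add: wsum_0 col_weight_def)
next
  case (Suc M)
  from Suc.prems show ?case
  proof (induction k)
    case 0
    \<comment> \<open>Both sides vanish, the right one through its factor
      \<open>i = 0\<close>.\<close>
    show ?case by (subst prod.lessThan_Suc_shift) (simp add: wsum_col_weight_0)
  next
    case (Suc k)
    let ?W = "\<lambda>k M. qfact k * wsum (col_weight k) R M"
    have "(1 - x ^ Suc k) * wsum (col_weight (Suc k)) R M =
        wsum (\<lambda>b. (1 / x ^ b - 1) * col_weight (Suc k) b) R (Suc M)"
      using wsum_col_weight_deficit[of "Suc k" R M] Suc.prems by (simp add: deficit_eq_0)
    then have "(1 - x ^ Suc k) * wsum (col_weight (Suc k)) R (Suc M) =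
        wsum (col_weight k) R (Suc M) + x ^ Suc k * ((1 - x ^ Suc k) * wsum (col_weight (Suc k)) R M)"
      using wsum_col_weight_Suc[of k R "Suc M"] by simp
    from arg_cong[where f = "(*) (qfact k)", OF this]
    have rec: "?W (Suc k) (Suc M) = ?W k (Suc M) + x ^ Suc k * ?W (Suc k) M"
      by (simp only: qfact_Suc distrib_left mult_ac)
    let ?P = "\<Prod>i<M. 1 - x ^ (Suc k + i)"
    have P: "(\<Prod>i<Suc M. 1 - x ^ (k + i)) = (1 - x ^ k) * ?P"
      by (subst prod.lessThan_Suc_shift) simp
    have "?W (Suc k) (Suc M) * qfact (Suc M) = ?W k (Suc M) * qfact (Suc M) +
        x ^ Suc k * (1 - x ^ Suc M) * (?W (Suc k) M * qfact M)"
      unfolding rec qfact_Suc[of M] by (simp add: algebra_simps)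
    also have "\<dots> = x ^ Suc M * ((1 - x ^ k) * ?P) + x ^ Suc k * (1 - x ^ Suc M) * (x ^ M * ?P)"
      \<comment> \<open>The fact quoted by its shape is the outer hypothesis for \<open>M\<close>
        and all \<open>k\<close>.\<close>
      using Suc.IH Suc.prems \<open>\<And>k. M \<le> R \<Longrightarrow> _ k\<close> by (simp only: P Suc_leD)
    also have "\<dots> = x ^ Suc M * (\<Prod>i<Suc M. 1 - x ^ (Suc k + i))"
      by (simp add: algebra_simps power_add)
    finally show ?case .
  qed
qed

lemma qfact_ratio_tendsto: "(\<lambda>k. qfact k * col_weight k b) \<longlonglongrightarrow> 1"
proof -
  have "(\<lambda>k. qfact (k + b) * col_weight (k + b) b) \<longlonglongrightarrow> 1"
  proof (induction b)
    case 0
    then show ?case using qfact_pos by (simp add: col_weight_def less_imp_neq[THEN not_sym])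
  next
    case (Suc b)
    have "(\<lambda>k. 1 - x ^ (k + Suc b)) \<longlonglongrightarrow> 1 - 0"
      using x_pos x_less_1
      by (intro tendsto_diff tendsto_const LIMSEQ_ignore_initial_segment LIMSEQ_realpow_zero) auto
    from tendsto_mult[OF this Suc]
    show ?case by (simp add: col_weight_def qfact_Suc mult.assoc)
  qed
  then show ?thesis by (rule LIMSEQ_offset)
qed

text \<open>This says that the measure on partitions of \<open>M\<close> has total mass 1.\<close>

lemma wsum_total:
  assumes "M \<le> R"
  shows "wsum (\<lambda>_. 1) R M * qfact M = x ^ M"
proof (rule LIMSEQ_unique)
  have "(\<lambda>k. (\<Sum>b\<le>M. colsum R M b * (qfact k * col_weight k b)) * qfact M)
      \<longlonglongrightarrow> (\<Sum>b\<le>M. colsum R M b * 1) * qfact M"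
    by (intro tendsto_intros qfact_ratio_tendsto)
  then show "(\<lambda>k. qfact k * wsum (col_weight k) R M * qfact M) \<longlonglongrightarrow> wsum (\<lambda>_. 1) R M * qfact M"
    by (simp add: wsum_def sum_distrib_left mult.left_commute)
  have "(\<lambda>k. x ^ M * (\<Prod>i<M. 1 - x ^ (k + i))) \<longlonglongrightarrow> x ^ M * (\<Prod>i<M. 1 - 0)"
    using x_pos x_less_1
    by (intro tendsto_intros LIMSEQ_ignore_initial_segment LIMSEQ_realpow_zero) auto
  then show "(\<lambda>k. qfact k * wsum (col_weight k) R M * qfact M) \<longlonglongrightarrow> x ^ M"
    by (simp add: wsum_col_weight_closed[OF assms])
qed

text \<open>The constant weight is fixed by the lift average, so \<open>c = 1\<close>; the bound
  \<open>Suc M\<close> admits all partitions of both sizes, and \<open>wsum_total\<close> evaluates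
  their sums.\<close>

lemma wsum_1_antimono:
  "qfact (Suc M) / x ^ Suc M * wsum (\<lambda>_. 1) r (Suc M) \<le> qfact M / x ^ M * wsum (\<lambda>_. 1) r M"
proof -
  let ?w = "\<lambda>s. wsum (\<lambda>_. 1 :: real) s"
  have "?w r (Suc M) * ?w (Suc M) M \<le> ?w r M * ?w (Suc M) (Suc M)"
    by (rule wsum_ratio_antimono[where c = 1]) (auto intro: ratio_mono)
  moreover have "?w (Suc M) M = x ^ M / qfact M" "?w (Suc M) (Suc M) = x ^ Suc M / qfact (Suc M)"
    using wsum_total[of M "Suc M"] wsum_total[of "Suc M" "Suc M"] qfact_pos
    by (simp_all add: field_simps less_imp_neq[THEN not_sym])
  ultimately show ?thesis
    using qfact_pos[of M] qfact_pos[of "Suc M"] x_pos by (simp add: field_simps)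
qed

section \<open>From partition sums back to the measures\<close>

text \<open>
  The reciprocal of the denominator of \<^const>\<open>partition_weight\<close>, when no part exceeds \<open>r\<close>.
\<close>
definition inv_aut :: "nat \<Rightarrow> nat multiset \<Rightarrow> real" where
  "inv_aut r l = (\<Prod>j<r. x ^ (size (filter_mset ((\<le>) (Suc j)) l))\<^sup>2 / qfact (count l (Suc j)))"

text \<open>The new column gives the factor \<open>j = 0\<close>; all other factors shift by
  one.\<close>

lemma inv_aut_add_column:
  assumes "0 \<notin># m" "size m \<le> a"
  shows "inv_aut (Suc r) (add_column a m) = x ^ a\<^sup>2 * (inv_aut r m * col_weight a (size m))"
  unfolding inv_aut_def prod.lessThan_Suc_shift
  using assms
  by (simp add: filter_add_column_1 size_filter_add_column count_add_column_1 count_add_column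
      size_add_column col_weight_def)

lemma sum_inv_aut: "(\<Sum>l | l \<in> bounded_partitions r N \<and> size l = a. inv_aut r l) = colsum r N a"
proof (induction r arbitrary: N a)
  case 0
  have "{l. l \<in> bounded_partitions 0 N \<and> size l = a} = (if N = 0 \<and> a = 0 then {{#}} else {})"
    by (auto simp: bounded_partitions_0)
  then show ?case by (simp add: inv_aut_def)
next
  case (Suc r)
  show ?case
  proof (cases "a \<le> N")
    case False
    then have "{l. l \<in> bounded_partitions (Suc r) N \<and> size l = a} = {}"
      using size_bounded_partitions by fastforce
    with False show ?thesis by (simp only: colsum_Suc sum.empty if_False)
  next
    case True
    let ?B = "bounded_partitions r (N - a)"
    have "wsum (col_weight a) r (N - a)
        = (\<Sum>b\<le>N - a. \<Sum>m | m \<in> ?B \<and> size m = b. inv_aut r m * col_weight a (size m))"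
      by (simp add: wsum_def sum_distrib_right flip: Suc)
    also have "\<dots> = (\<Sum>m\<in>?B. inv_aut r m * col_weight a (size m))"
      by (rule sum.group) (auto simp: finite_bounded_partitions size_bounded_partitions)
    also have "\<dots> = (\<Sum>m | m \<in> ?B \<and> size m \<le> a. inv_aut r m * col_weight a (size m))"
      by (rule sum.mono_neutral_right) (auto simp: finite_bounded_partitions col_weight_def)
    finally have "x ^ a\<^sup>2 * wsum (col_weight a) r (N - a)
        = (\<Sum>m | m \<in> ?B \<and> size m \<le> a. x ^ a\<^sup>2 * (inv_aut r m * col_weight a (size m)))"
      by (simp add: sum_distrib_left)
    also have "\<dots> = (\<Sum>m | m \<in> ?B \<and> size m \<le> a. inv_aut (Suc r) (add_column a m))"
      by (intro sum.cong refl) (auto simp: inv_aut_add_column bounded_partitions_def)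
    also have "\<dots> = (\<Sum>l | l \<in> bounded_partitions (Suc r) N \<and> size l = a. inv_aut (Suc r) l)"
      by (rule sum.reindex_bij_betw) (rule bij_betw_add_column[OF True])
    finally show ?thesis using True by (simp add: colsum_Suc)
  qed
qed

lemma prob_eq_wsum:
  assumes "1 \<le> r"
  shows "prob_largest_part_less (1 / x) r N = qfact N / x ^ N * wsum (\<lambda>_. 1) (r - 1) N"
proof -
  have poch: "q_poch (1 / x) x n = qfact n" for n
    by (simp add: q_poch_def qfact_def power_one_over)
  have weight: "partition_weight (1 / x) N l = qfact N / x ^ N * inv_aut (r - 1) l"
    if l: "l \<in> bounded_partitions (r - 1) N" for l
  proof -
    have "(\<Prod>j = 1..largest_part l. (1 / x) ^ (transpose_part l j)\<^sup>2 * qfact (count l j))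
        = (\<Prod>j = 1..r - 1. (1 / x) ^ (transpose_part l j)\<^sup>2 * qfact (count l j))"
    \<comment> \<open>Factors beyond the largest part are 1, so one range serves every
      partition.\<close>
    proof (rule prod.mono_neutral_left)
      show "{1..largest_part l} \<subseteq> {1..r - 1}"
        using l by (auto simp: bounded_partitions_alt)
      show "\<forall>j\<in>{1..r - 1} - {1..largest_part l}. (1 / x) ^ (transpose_part l j)\<^sup>2 * qfact (count l j) = 1"
      proof
        fix j assume "j \<in> {1..r - 1} - {1..largest_part l}"
        then have j: "largest_part l < j" by auto
        then have "j \<notin># l" using le_largest_part[of j l] by auto
        with j show "(1 / x) ^ (transpose_part l j)\<^sup>2 * qfact (count l j) = 1"
          by (simp add: transpose_part_def not_in_iff)
      qed
    qed simp
    also have "\<dots> = (\<Prod>j<r - 1. (1 / x) ^ (transpose_part l (Suc j))\<^sup>2 * qfact (count l (Suc j)))"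
      by (simp add: prod.atLeast1_atMost_eq)
    finally show ?thesis
      by (simp add: partition_weight_def inv_aut_def poch power_one_over transpose_part_eq
          prod_dividef prod.distrib)
  qed
  have "prob_largest_part_less (1 / x) r N = (\<Sum>l\<in>bounded_partitions (r - 1) N. partition_weight (1 / x) N l)"
    using x_pos x_less_1 assms
    by (subst prob_largest_part_less_eq_sum) (auto intro!: sum.cong simp: bounded_partitions_alt)
  also have "\<dots> = qfact N / x ^ N * (\<Sum>l\<in>bounded_partitions (r - 1) N. inv_aut (r - 1) l)"
    unfolding sum_distrib_left by (intro sum.cong refl weight)
  also have "(\<Sum>l\<in>bounded_partitions (r - 1) N. inv_aut (r - 1) l)
      = (\<Sum>a\<le>N. \<Sum>l | l \<in> bounded_partitions (r - 1) N \<and> size l = a. inv_aut (r - 1) l)"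
    by (rule sum.group[symmetric]) (auto simp: finite_bounded_partitions size_bounded_partitions)
  also have "\<dots> = wsum (\<lambda>_. 1) (r - 1) N"
    by (simp add: sum_inv_aut wsum_def)
  finally show ?thesis .
qed

end

theorem theorem4:
  fixes q :: real and n r :: nat
  assumes "q \<ge> 2" and "r \<ge> 1"
  shows "prob_largest_part_less q r n \<ge> prob_largest_part_less q r (n + 1)"
proof -
  interpret base_inverse "1 / q"
    using assms by unfold_locales auto
  have "prob_largest_part_less q r N =
      qfact N / (1 / q) ^ N * wsum (\<lambda>_. 1) (r - 1) N" for N
    using prob_eq_wsum[of r N] assms by simp
  then show ?thesis
    using wsum_1_antimono[of n "r - 1"] by (simp only: Suc_eq_plus1)
qed

end
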